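(* Let $n\ge 1$ and let $T=(a_{i,j})_{n\ge i\ge j\ge 1}$ be a monotone triangle of size $n$. Let $\Delta(T)=(b_{i,j})_{n\ge i\ge j\ge 1}$ be the triangle defined by $b_{i,j}=a_{i,j}+i-j$. Then $\Delta(T)$ is a Magog triangle if and only if $T$ is gapless. Furthermore, in this case $\Delta(T)$ is a gapless Magog triangle.
   Context: A monotone triangle of size $n$ is an array $(a_{i,j})$ of positive integers, defined for $n\ge i\ge j\ge 1$, such that $a_{i,j}<a_{i,j+1}$, $a_{i,j}\le a_{i-1,j}$ and $a_{i,j}\le a_{i+1,j+1}$ whenever both sides are defined, and $a_{n,j}=j$ for all $1\le j\le n$. It contains a gap at position $(i,j)$ (where $1\le j\le i<n$) if $a_{i,j}-a_{i+1,j}>1$; it is gapless if it contains no gaps. A Magog triangle of size $n$ is an array $(b_{i,j})$ of positive integers, defined for $n\ge i\ge j\ge 1$, such that (1) $b_{i,j}\le n$; (2) $b_{i,j}\le b_{i+1,j}$ and $b_{i,j}\le b_{i,j+1}$ whenever both sides are defined; (3) $b_{i,j}\ge i$. A Magog triangle contains a gap at position $(i,j)$ (where $1\le j\le i<n$) if $b_{i+1,j}-b_{i,j}>1$; a gapless Magog triangle is a Magog triangle with no gaps. *)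

theory Defs
  imports Main
begin

text \<open>
  A triangular array of size \<open>n\<close> is represented by a total function
  \<open>nat \<Rightarrow> nat \<Rightarrow> int\<close>, of which only the values on the index set below matter: every
  predicate inspects the array at indices of the triangle only. Entries are integers, with positivity
  required explicitly, so that the differences occurring in gaps and in \<open>Delta\<close> are not truncated.
\<close>

definition tri_index :: "nat \<Rightarrow> (nat \<times> nat) set" where
  "tri_index n = {(i, j). n \<ge> i \<and> i \<ge> j \<and> j \<ge> 1}"

definition monotone_triangle :: "nat \<Rightarrow> (nat \<Rightarrow> nat \<Rightarrow> int) \<Rightarrow> bool" where
  "monotone_triangle n a \<longleftrightarrow>
     (\<forall>(i, j) \<in> tri_index n.
        a i j > 0 \<and>
        ((i, j + 1) \<in> tri_index n \<longrightarrow> a i j < a i (j + 1)) \<and>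
        ((i - 1, j) \<in> tri_index n \<longrightarrow> a i j \<le> a (i - 1) j) \<and>
        ((i + 1, j + 1) \<in> tri_index n \<longrightarrow> a i j \<le> a (i + 1) (j + 1))) \<and>
     (\<forall>j. 1 \<le> j \<and> j \<le> n \<longrightarrow> a n j = int j)"

definition monotone_gap_at :: "nat \<Rightarrow> (nat \<Rightarrow> nat \<Rightarrow> int) \<Rightarrow> nat \<Rightarrow> nat \<Rightarrow> bool" where
  "monotone_gap_at n a i j \<longleftrightarrow> 1 \<le> j \<and> j \<le> i \<and> i < n \<and> a i j - a (i + 1) j > 1"

definition gapless_monotone_triangle :: "nat \<Rightarrow> (nat \<Rightarrow> nat \<Rightarrow> int) \<Rightarrow> bool" where
  "gapless_monotone_triangle n a \<longleftrightarrow>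
     monotone_triangle n a \<and> (\<nexists>i j. monotone_gap_at n a i j)"

definition magog_triangle :: "nat \<Rightarrow> (nat \<Rightarrow> nat \<Rightarrow> int) \<Rightarrow> bool" where
  "magog_triangle n b \<longleftrightarrow>
     (\<forall>(i, j) \<in> tri_index n.
        b i j > 0 \<and>
        b i j \<le> int n \<and>
        ((i + 1, j) \<in> tri_index n \<longrightarrow> b i j \<le> b (i + 1) j) \<and>
        ((i, j + 1) \<in> tri_index n \<longrightarrow> b i j \<le> b i (j + 1)) \<and>
        b i j \<ge> int i)"

definition magog_gap_at :: "nat \<Rightarrow> (nat \<Rightarrow> nat \<Rightarrow> int) \<Rightarrow> nat \<Rightarrow> nat \<Rightarrow> bool" where
  "magog_gap_at n b i j \<longleftrightarrow> 1 \<le> j \<and> j \<le> i \<and> i < n \<and> b (i + 1) j - b i j > 1"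

definition gapless_magog_triangle :: "nat \<Rightarrow> (nat \<Rightarrow> nat \<Rightarrow> int) \<Rightarrow> bool" where
  "gapless_magog_triangle n b \<longleftrightarrow>
     magog_triangle n b \<and> (\<nexists>i j. magog_gap_at n b i j)"

definition Delta :: "(nat \<Rightarrow> nat \<Rightarrow> int) \<Rightarrow> nat \<Rightarrow> nat \<Rightarrow> int" where
  "Delta a i j = a i j + int i - int j"

end

theory Submission
  imports Defs
begin

text \<open>
  Passing to \<open>Delta a\<close> turns a vertical step \<open>a i j - a (i + 1) j\<close> of \<open>a\<close> into the step
  \<open>1 - (a i j - a (i + 1) j)\<close> between the entries at \<open>(i, j)\<close> and \<open>(i + 1, j)\<close>, because the shift
  \<open>i - j\<close> grows by one with \<open>i\<close>. Hence the columns of \<open>Delta a\<close> increase weakly exactly when no step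
  of \<open>a\<close> exceeds \<open>1\<close>, that is, when \<open>a\<close> is gapless. This is the only Magog condition that can fail.
  Rows stay weakly increasing because those of \<open>a\<close> increase strictly, and the bounds
  \<open>i \<le> Delta a i j \<le> n\<close> say that \<open>j \<le> a i j \<le> n - i + j\<close>: a column descends to the entry \<open>j\<close> of the
  bottom row, and a diagonal ascends to its entry \<open>n - i + j\<close>. Finally, the columns of \<open>a\<close> decrease
  weakly, so every vertical step of \<open>Delta a\<close> is at most \<open>1\<close>, and \<open>Delta a\<close> never has a gap.
\<close>

lemma monotone_triangle_row:
  assumes "monotone_triangle n a" "1 \<le> j" "j < i" "i \<le> n"
  shows "a i j < a i (j + 1)"
  using assms unfolding monotone_triangle_def tri_index_def by auto

lemma monotone_triangle_column:
  assumes "monotone_triangle n a" "1 \<le> j" "j \<le> i" "i < n"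
  shows "a (i + 1) j \<le> a i j"
proof -
  have "(i + 1, j) \<in> tri_index n" "(i + 1 - 1, j) \<in> tri_index n"
    using assms by (auto simp: tri_index_def)
  then show ?thesis
    using assms(1) unfolding monotone_triangle_def by fastforce
qed

lemma monotone_triangle_diagonal:
  assumes "monotone_triangle n a" "1 \<le> j" "j \<le> i" "i < n"
  shows "a i j \<le> a (i + 1) (j + 1)"
  using assms unfolding monotone_triangle_def tri_index_def by auto

lemma monotone_triangle_lower_bound:
  assumes "monotone_triangle n a" "1 \<le> j" "j \<le> i" "i \<le> n"
  shows "int j \<le> a i j"
  using \<open>i \<le> n\<close> \<open>j \<le> i\<close>
proof (induction i rule: inc_induct)
  case base
  then show ?case
    using assms unfolding monotone_triangle_def by simp
next
  case (step i)
  then show ?case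
    using monotone_triangle_column[OF assms(1,2), of i] by simp
qed

lemma monotone_triangle_upper_bound:
  assumes "monotone_triangle n a" "1 \<le> j" "j \<le> i" "i \<le> n"
  shows "a i j \<le> int n - int i + int j"
  using \<open>i \<le> n\<close> \<open>1 \<le> j\<close> \<open>j \<le> i\<close>
proof (induction i arbitrary: j rule: inc_induct)
  case base
  then show ?case
    using assms(1) unfolding monotone_triangle_def by simp
next
  case (step i)
  then show ?case
    using monotone_triangle_diagonal[OF assms(1), of j i] step.IH[of "j + 1"] by simp
qed

lemma magog_column:
  assumes "magog_triangle n b" "1 \<le> j" "j \<le> i" "i < n"
  shows "b i j \<le> b (i + 1) j"
  using assms unfolding magog_triangle_def tri_index_def by auto

lemma gapless_if_magog_Delta:
  assumes "monotone_triangle n a" "magog_triangle n (Delta a)"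
  shows "gapless_monotone_triangle n a"
  using assms(1) magog_column[OF assms(2)]
  unfolding gapless_monotone_triangle_def monotone_gap_at_def Delta_def by fastforce

lemma magog_Delta_if_gapless:
  assumes "gapless_monotone_triangle n a"
  shows "magog_triangle n (Delta a)"
proof -
  have mono: "monotone_triangle n a"
    using assms unfolding gapless_monotone_triangle_def by simp
  have step: "a i j \<le> a (i + 1) j + 1" if "1 \<le> j" "j \<le> i" "i < n" for i j
    using assms that unfolding gapless_monotone_triangle_def monotone_gap_at_def
    by (metis diff_le_eq not_le add.commute)
  have "Delta a i j > 0 \<and> Delta a i j \<le> int n \<and>
      ((i + 1, j) \<in> tri_index n \<longrightarrow> Delta a i j \<le> Delta a (i + 1) j) \<and>
      ((i, j + 1) \<in> tri_index n \<longrightarrow> Delta a i j \<le> Delta a i (j + 1)) \<and>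
      Delta a i j \<ge> int i"
    if "(i, j) \<in> tri_index n" for i j
  proof -
    have ij: "1 \<le> j" "j \<le> i" "i \<le> n"
      using that by (auto simp: tri_index_def)
    then show ?thesis
      using monotone_triangle_lower_bound[OF mono ij] monotone_triangle_upper_bound[OF mono ij]
        step[of j i] monotone_triangle_row[OF mono, of j i]
      by (auto simp: Delta_def tri_index_def)
  qed
  then show ?thesis
    unfolding magog_triangle_def by blast
qed

lemma Delta_has_no_magog_gap:
  assumes "monotone_triangle n a"
  shows "\<not> magog_gap_at n (Delta a) i j"
  using monotone_triangle_column[OF assms, of j i]
  unfolding magog_gap_at_def Delta_def by auto

theorem theorem4:
  fixes n :: nat and a :: "nat \<Rightarrow> nat \<Rightarrow> int"
  assumes "n \<ge> 1"
    and "monotone_triangle n a"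
  shows "(magog_triangle n (Delta a) \<longleftrightarrow> gapless_monotone_triangle n a) \<and>
         (gapless_monotone_triangle n a \<longrightarrow> gapless_magog_triangle n (Delta a))"
  using gapless_if_magog_Delta[OF assms(2)] magog_Delta_if_gapless
    Delta_has_no_magog_gap[OF assms(2)]
  unfolding gapless_magog_triangle_def by blast

end
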